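(* Let $x$ and $k$ be indeterminates, let $K=\mathbb{Q}(x,k)$, and let $A_n^{(k)}(x)$, $n\ge 0$, be the $1/k$-Eulerian polynomials. Let $M$ be the exponential Riordan array $$M=\left[\frac{1}{(1+kz)^{1/k}},\ \frac{1}{k(1-x)}\ln\left(\frac{1+kz}{1+kxz}\right)\right]$$ over $K$. Then $M$ is the coefficient array of a family of orthogonal polynomials over $K$ whose moments are the $1/k$-Eulerian polynomials $(A_n^{(k)}(x))_{n\ge 0}$. Moreover, the inverse matrix of $M$ is the exponential Riordan array $$M^{-1}=\left[\left(\frac{1-x}{e^{kz(x-1)}-x}\right)^{1/k},\ \frac{e^{kz}-e^{kxz}}{k(e^{kxz}-xe^{kz})}\right],$$ and the $1/k$-Eulerian polynomials appear as its initial column, i.e. $(M^{-1})_{n,0}=A_n^{(k)}(x)$ for all $n\ge 0$.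
   Context: The Savage-Viswanathan polynomials $F_n(x,y)$ are defined by the exponential generating function $\sum_{n\ge 0}F_n(x,y)\frac{z^n}{n!}=\left(\frac{1-x}{e^{z(x-1)}-x}\right)^y$ (a formal power series in $z$; the base has constant term $1$). They are polynomials in $x,y$. The $1/k$-Eulerian polynomials are $A_n^{(k)}(x)=k^nF_n(x,1/k)$. All series are formal power series in $z$; for a series $u$ with constant term $1$, $u^{c}=\exp(c\ln u)$. For formal power series $g(z)$ with $g(0)\ne 0$ and $f(z)=f_1z+f_2z^2+\cdots$ with $f_1\neq 0$, the exponential Riordan array $[g,f]$ is the infinite lower-triangular matrix $(a_{n,j})_{n,j\ge 0}$ whose $j$-th column has exponential generating function $g(z)f(z)^j/j!$, i.e. $a_{n,j}=n!\,[z^n]\,g(z)f(z)^j/j!$. A lower-triangular matrix $(a_{n,j})$ is the coefficient array of the polynomials $p_n(z)=\sum_{j=0}^n a_{n,j}z^j$. A sequence of monic polynomials $(p_n)_{n\ge0}$ over a field $K$ with $\deg p_n=n$ is (formally) orthogonal with moments $(\mu_n)_{n\ge 0}$ if the $K$-linear functional $\mathcal{L}$ on $K[z]$ with $\mathcal{L}(z^n)=\mu_n$ satisfies $\mathcal{L}(p_mp_n)=0$ for $m\neq n$ and $\mathcal{L}(p_n^2)\ne 0$ for all $n$. *)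

theory Defs
  imports "HOL-Computational_Algebra.Computational_Algebra"
begin

unbundle fps_syntax

text \<open>
  \<open>\<rat>(x, k)\<close> is represented as the field of fractions of \<open>\<rat>[x][k]\<close>: the inner polynomials
  are polynomials in \<open>x\<close>, the outer ones are polynomials in \<open>k\<close>.
\<close>

type_synonym rat_fun2 = "rat poly poly fract"

definition indet_x :: rat_fun2 where
  "indet_x = to_fract [:[:0, 1:]:]"

definition indet_k :: rat_fun2 where
  "indet_k = to_fract [:0, 1:]"

text \<open>
  The next two definitions are meaningful for series \<open>u\<close> with constant term \<open>1\<close>; note that
  the library series \<open>fps_ln 1\<close> stands for \<open>ln (1 + z)\<close>.
\<close>

definition fps_log :: "'a::field_char_0 fps \<Rightarrow> 'a fps" where
  "fps_log u = fps_ln 1 oo (u - 1)"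

definition fps_cpow :: "'a::field_char_0 fps \<Rightarrow> 'a \<Rightarrow> 'a fps" where
  "fps_cpow u c = fps_exp 1 oo (fps_const c * fps_log u)"

text \<open>
  The Savage--Viswanathan polynomial \<open>F\<^sub>n\<close> evaluated at elements \<open>x \<noteq> 1\<close> and \<open>y\<close> of a field
  of characteristic 0. Its generating function is taken directly at the given arguments.
\<close>

definition savage_viswanathan :: "nat \<Rightarrow> 'a::field_char_0 \<Rightarrow> 'a \<Rightarrow> 'a" where
  "savage_viswanathan n x y =
     fact n * fps_cpow (fps_const (1 - x) / (fps_exp (x - 1) - fps_const x)) y $ n"

definition eulerian_1k :: "'a::field_char_0 \<Rightarrow> nat \<Rightarrow> 'a \<Rightarrow> 'a" where
  "eulerian_1k k n x = k ^ n * savage_viswanathan n x (1 / k)"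

text \<open>Infinite matrices are functions of the row index and the column index.\<close>

definition lower_triangular :: "(nat \<Rightarrow> nat \<Rightarrow> 'a::zero) \<Rightarrow> bool" where
  "lower_triangular A \<longleftrightarrow> (\<forall>n j. n < j \<longrightarrow> A n j = 0)"

text \<open>
  Row \<open>n\<close> of a lower-triangular matrix vanishes beyond column \<open>n\<close>, so for such \<open>A\<close> the
  truncated sum is the full matrix product.
\<close>

definition ltri_mult ::
  "(nat \<Rightarrow> nat \<Rightarrow> 'a::comm_ring_1) \<Rightarrow> (nat \<Rightarrow> nat \<Rightarrow> 'a) \<Rightarrow> nat \<Rightarrow> nat \<Rightarrow> 'a" where
  "ltri_mult A B n j = (\<Sum>i\<le>n. A n i * B i j)"

definition identity_matrix :: "nat \<Rightarrow> nat \<Rightarrow> 'a::comm_ring_1" where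
  "identity_matrix n j = (if n = j then 1 else 0)"

definition inverse_ltri ::
  "(nat \<Rightarrow> nat \<Rightarrow> 'a::comm_ring_1) \<Rightarrow> (nat \<Rightarrow> nat \<Rightarrow> 'a) \<Rightarrow> bool" where
  "inverse_ltri A B \<longleftrightarrow>
     lower_triangular A \<and> lower_triangular B \<and>
     ltri_mult A B = identity_matrix \<and> ltri_mult B A = identity_matrix"

definition riordan_pair :: "'a::field_char_0 fps \<Rightarrow> 'a fps \<Rightarrow> bool" where
  "riordan_pair g f \<longleftrightarrow> g $ 0 \<noteq> 0 \<and> f $ 0 = 0 \<and> f $ 1 \<noteq> 0"

definition exp_riordan :: "'a::field_char_0 fps \<Rightarrow> 'a fps \<Rightarrow> nat \<Rightarrow> nat \<Rightarrow> 'a" where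
  "exp_riordan g f n j = fact n * (g * f ^ j / fps_const (fact j)) $ n"

definition is_coefficient_array ::
  "(nat \<Rightarrow> nat \<Rightarrow> 'a::comm_ring_1) \<Rightarrow> (nat \<Rightarrow> 'a poly) \<Rightarrow> bool" where
  "is_coefficient_array A p \<longleftrightarrow>
     lower_triangular A \<and> (\<forall>n. p n = (\<Sum>j\<le>n. monom (A n j) j))"

definition orthogonal_polys :: "(nat \<Rightarrow> 'a::field poly) \<Rightarrow> (nat \<Rightarrow> 'a) \<Rightarrow> bool" where
  "orthogonal_polys p \<mu> \<longleftrightarrow>
     (\<forall>n. degree (p n) = n \<and> lead_coeff (p n) = 1) \<and>
     (\<exists>L. Vector_Spaces.linear smult (*) L \<and>
          (\<forall>n. L (monom 1 n) = \<mu> n) \<and>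
          (\<forall>m n. m \<noteq> n \<longrightarrow> L (p m * p n) = 0) \<and>
          (\<forall>n. L ((p n)\<^sup>2) \<noteq> 0))"

end

theory Submission
  imports Defs
begin

text \<open>
  Composition of Riordan arrays is composition of series, so \<open>M\<inverse>\<close> is verified by computing
  \<open>F \<circ> f = z\<close> and \<open>g (G \<circ> f) = 1\<close>; both follow from \<open>e\<^bsup>k(1-x)f\<^esup> = (1 + kz) / (1 + kxz)\<close>.
  The column \<open>a\<^sub>j = g f\<^sup>j / j!\<close> of \<open>M\<close> satisfies
  \<open>(1 + kz)(1 + kxz) a\<^sub>j' = -(1 + kxz) a\<^sub>j + a\<^bsub>j-1\<^esub>\<close>, which on coefficients is the recurrence
  \<open>w p\<^sub>n = p\<^bsub>n+1\<^esub> + (1 + k(1+x)n) p\<^sub>n + xkn(1 + k(n-1)) p\<^bsub>n-1\<^esub>\<close>. Since the functional with moments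
  \<open>N\<^bsub>n,0\<^esub>\<close> kills \<open>p\<^sub>n\<close> for \<open>n > 0\<close> (as \<open>M N = I\<close>) and the last coefficient never vanishes for
  \<open>n > 0\<close>, orthogonality is the easy direction of Favard's theorem.
\<close>

subsection \<open>Logarithms and powers of formal power series\<close>

lemma fps_div_eqI:
  fixes a b c :: "'a::field fps"
  assumes "b \<noteq> 0" "a = c * b"
  shows "a / b = c"
  using assms by simp

lemma fps_log_nth_0 [simp]: "fps_log u $ 0 = 0"
  by (simp add: fps_log_def)

lemma fps_cpow_nth_0 [simp]: "fps_cpow u c $ 0 = 1"
  by (simp add: fps_cpow_def)

lemma fps_cpow_neq_0 [simp]: "fps_cpow u c \<noteq> 0"
  using fps_cpow_nth_0[of u c] by (metis fps_zero_nth zero_neq_one)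

text \<open>\<open>fps_ln 1\<close> is the compositional inverse of \<open>fps_exp 1 - 1\<close>;
  substituting \<open>u - 1\<close> into the resulting series \<open>1 + z\<close> gives
  \<open>u\<close>.\<close>

lemma fps_exp_compose_log:
  assumes "u $ 0 = 1"
  shows "fps_exp 1 oo fps_log u = u"
proof -
  have ln: "fps_ln 1 $ 0 = (0::'a)" by simp
  have u: "(u - 1) $ 0 = 0" using assms by simp
  have "(fps_exp 1 - 1) oo fps_ln 1 = (fps_X :: 'a fps)"
    using fps_inv_fps_exp_compose(2)[of "1::'a"] by (simp add: fps_ln_fps_exp_inv)
  then have "fps_exp 1 oo fps_ln 1 = (1 + fps_X :: 'a fps)"
    by (simp add: fps_compose_sub_distrib algebra_simps)
  then have "fps_exp 1 oo fps_log u = (1 + fps_X) oo (u - 1)"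
    unfolding fps_log_def fps_compose_assoc[OF u ln] by simp
  also have "\<dots> = u"
    using u by (simp only: fps_compose_add_distrib fps_compose_1 fps_X_fps_compose_startby0) simp
  finally show ?thesis .
qed

lemma fps_exp_compose:
  fixes f :: "'a::field_char_0 fps"
  assumes "f $ 0 = 0"
  shows "fps_exp c oo f = fps_exp 1 oo (fps_const c * f)"
proof -
  have "fps_exp c = fps_exp 1 oo (fps_const c * fps_X)" by simp
  also have "\<dots> oo f = fps_exp 1 oo ((fps_const c * fps_X) oo f)"
    by (rule fps_compose_assoc[symmetric]) (use assms in auto)
  also have "(fps_const c * fps_X) oo f = fps_const c * f"
    using assms by (simp add: fps_compose_mult_distrib)
  finally show ?thesis .
qed

text \<open>Associativity of composition moves \<open>h\<close> through exp and ln. This serves the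
  rescaling of \<open>z\<close> by \<open>k\<close> and the evaluation of \<open>G\<close> at
  \<open>f\<close>.\<close>

lemma fps_cpow_compose:
  fixes u h :: "'a::field_char_0 fps"
  assumes h: "h $ 0 = 0" and u: "u $ 0 = 1"
  shows "fps_cpow u c oo h = fps_cpow (u oo h) c"
proof -
  have u1: "(u - 1) $ 0 = 0" using u by simp
  have "fps_log u oo h = fps_ln 1 oo ((u - 1) oo h)"
    unfolding fps_log_def by (rule fps_compose_assoc[OF h u1, symmetric])
  then have "fps_log u oo h = fps_log (u oo h)"
    by (simp add: fps_log_def fps_compose_sub_distrib)
  then have "(fps_const c * fps_log u) oo h = fps_const c * fps_log (u oo h)"
    by (simp add: fps_compose_mult_distrib[OF h])
  then show ?thesis
    unfolding fps_cpow_def by (subst fps_compose_assoc[OF h, symmetric]) simp_all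
qed

lemma fps_deriv_log:
  fixes u :: "'a::field_char_0 fps"
  assumes "u $ 0 = 1"
  shows "u * fps_deriv (fps_log u) = fps_deriv u"
proof -
  have u1: "(u - 1) $ 0 = 0" using assms by simp
  have "fps_deriv (fps_log u) = inverse ((1 + fps_X) oo (u - 1)) * fps_deriv u"
    unfolding fps_log_def using u1
    by (simp add: fps_compose_deriv[OF u1] fps_ln_deriv fps_inverse_compose)
  also have "(1 + fps_X) oo (u - 1) = u"
    using u1 by (simp only: fps_compose_add_distrib fps_compose_1 fps_X_fps_compose_startby0) simp
  finally show ?thesis using assms by (simp add: inverse_mult_eq_1' mult.assoc[symmetric])
qed

lemma fps_deriv_cpow:
  fixes u :: "'a::field_char_0 fps"
  assumes "u $ 0 = 1"
  shows "u * fps_deriv (fps_cpow u c) = fps_const c * fps_deriv u * fps_cpow u c"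
proof -
  have "fps_deriv (fps_cpow u c) = fps_cpow u c * (fps_const c * fps_deriv (fps_log u))"
    unfolding fps_cpow_def by (subst fps_compose_deriv) simp_all
  then have "u * fps_deriv (fps_cpow u c) =
      fps_cpow u c * (fps_const c * (u * fps_deriv (fps_log u)))"
    by (simp add: mult_ac)
  also have "u * fps_deriv (fps_log u) = fps_deriv u" by (rule fps_deriv_log[OF assms])
  finally show ?thesis by (simp add: mult_ac)
qed

subsection \<open>Exponential Riordan arrays\<close>

lemma exp_riordan_column:
  "exp_riordan g f n j = fact n * (g * (fps_const (1 / fact j) * f ^ j)) $ n"
  by (simp add: exp_riordan_def fps_divide_unit fps_const_inverse mult_ac inverse_eq_divide)

lemma lower_triangular_exp_riordan:
  assumes "f $ 0 = 0"
  shows "lower_triangular (exp_riordan g f)"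
proof -
  have "(g * (fps_const (1 / fact j) * f ^ j)) $ n = 0" if "n < j" for n j
  proof -
    have "f ^ j $ i = 0" if "i \<le> n" for i
      using startsby_zero_power_prefix[OF assms] \<open>n < j\<close> that by simp
    then show ?thesis by (simp add: fps_mult_nth)
  qed
  then show ?thesis by (simp add: lower_triangular_def exp_riordan_column)
qed

lemma exp_riordan_diag:
  assumes "f $ 0 = 0"
  shows "exp_riordan g f n n = g $ 0 * (f $ 1) ^ n"
proof -
  have "(g * (fps_const (1 / fact n) * f ^ n)) $ n =
      (\<Sum>i=0..n. g $ i * (f ^ n $ (n - i) / fact n))"
    unfolding fps_mult_nth[of g] by simp
  also have "\<dots> = (\<Sum>i\<in>{0}. g $ i * (f ^ n $ (n - i) / fact n))"
    by (rule sum.mono_neutral_right) (use startsby_zero_power_prefix[OF assms] in auto)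
  also have "\<dots> = g $ 0 * (f $ 1) ^ n / fact n"
    using startsby_zero_power_nth_same[OF assms, of n] by simp
  finally show ?thesis by (simp add: exp_riordan_column)
qed

text \<open>The fundamental theorem of Riordan arrays, stripped of factorials: the array of
  \<open>g\<close> and \<open>f\<close> acts on the coefficients of \<open>h\<close>.\<close>

lemma fps_mult_compose_nth:
  fixes g h f :: "'a::field_char_0 fps"
  assumes "f $ 0 = 0"
  shows "(g * (h oo f)) $ n = (\<Sum>i\<le>n. (g * f ^ i) $ n * h $ i)"
proof -
  \<comment> \<open>\<open>f ^ i\<close> has no terms below \<open>z^i\<close>, so all inner sums
    may share the bound \<open>n\<close> and the two sums can be swapped.\<close>
  have "(h oo f) $ m = (\<Sum>i\<le>n. h $ i * f ^ i $ m)" if "m \<le> n" for m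
    unfolding fps_compose_nth
    by (rule sum.mono_neutral_left)
       (use that startsby_zero_power_prefix[OF assms] in auto)
  then have "(g * (h oo f)) $ n = (\<Sum>m=0..n. g $ m * (\<Sum>i\<le>n. h $ i * f ^ i $ (n - m)))"
    by (simp add: fps_mult_nth)
  also have "\<dots> = (\<Sum>i\<le>n. \<Sum>m=0..n. g $ m * (h $ i * f ^ i $ (n - m)))"
    unfolding sum_distrib_left by (rule sum.swap)
  also have "\<dots> = (\<Sum>i\<le>n. (g * f ^ i) $ n * h $ i)"
    by (simp add: fps_mult_nth sum_distrib_left sum_distrib_right mult_ac)
  finally show ?thesis .
qed

text \<open>Column \<open>j\<close> of the second array has generating function
  \<open>G F^j / j!\<close>. The first array acts on it as above, the \<open>1 / i!\<close> of its
  column \<open>i\<close> cancelling the \<open>i!\<close> of row \<open>i\<close>.\<close>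

lemma ltri_mult_exp_riordan:
  fixes g f G F :: "'a::field_char_0 fps"
  assumes f: "f $ 0 = 0"
  shows "ltri_mult (exp_riordan g f) (exp_riordan G F) = exp_riordan (g * (G oo f)) (F oo f)"
proof (intro ext)
  fix n j
  let ?h = "G * (fps_const (1 / fact j) * F ^ j)"
  have "(?h oo f) = (G oo f) * (fps_const (1 / fact j) * (F oo f) ^ j)"
    by (simp add: fps_compose_mult_distrib[OF f] fps_compose_power[OF f])
  then have "exp_riordan (g * (G oo f)) (F oo f) n j = fact n * (g * (?h oo f)) $ n"
    by (simp add: exp_riordan_column mult.assoc)
  also have "\<dots> = (\<Sum>i\<le>n. fact n * ((g * f ^ i) $ n * ?h $ i))"
    by (simp add: fps_mult_compose_nth[OF f] sum_distrib_left)
  also have "\<dots> = (\<Sum>i\<le>n. exp_riordan g f n i * exp_riordan G F i j)"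
    by (rule sum.cong)
       (simp_all add: exp_riordan_column mult.left_commute[of _ "fps_const _"])
  finally show "ltri_mult (exp_riordan g f) (exp_riordan G F) n j =
      exp_riordan (g * (G oo f)) (F oo f) n j"
    by (simp add: ltri_mult_def)
qed

lemma exp_riordan_identity: "exp_riordan 1 fps_X = (identity_matrix :: nat \<Rightarrow> nat \<Rightarrow> 'a::field_char_0)"
  by (intro ext) (simp add: exp_riordan_column identity_matrix_def)

text \<open>Since \<open>f $ 1 \<noteq> 0\<close>, \<open>F\<close> must be the two-sided
  compositional inverse of \<open>f\<close>; composing \<open>g * (G oo f) = 1\<close> with
  \<open>F\<close> then gives the product in the other order.\<close>

lemma inverse_ltri_exp_riordan:
  fixes g f G F :: "'a::field_char_0 fps"
  assumes f: "f $ 0 = 0" "f $ 1 \<noteq> 0" and F: "F $ 0 = 0"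
    and Ff: "F oo f = fps_X" and Gf: "g * (G oo f) = 1"
  shows "inverse_ltri (exp_riordan g f) (exp_riordan G F)"
proof -
  have inv0: "fps_inv f $ 0 = 0" by (simp add: fps_inv_def)
  have "F oo (f oo fps_inv f) = (F oo f) oo fps_inv f"
    by (rule fps_compose_assoc[OF inv0 f(1)])
  then have F_eq: "F = fps_inv f"
    by (simp add: Ff fps_inv_right[OF f] inv0)
  have fF: "f oo F = fps_X"
    unfolding F_eq by (rule fps_inv_right[OF f])
  have "(g * (G oo f)) oo F = (g oo F) * (G oo (f oo F))"
    by (simp add: fps_compose_mult_distrib[OF F] fps_compose_assoc[OF F f(1)])
  then have "G * (g oo F) = 1"
    by (simp add: Gf fF mult.commute)
  then show ?thesis
    unfolding inverse_ltri_def
    using lower_triangular_exp_riordan[OF f(1), of g] lower_triangular_exp_riordan[OF F, of G]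
    by (simp add: ltri_mult_exp_riordan f F Ff Gf fF exp_riordan_identity)
qed

subsection \<open>Orthogonality from a three-term recurrence\<close>

lemma linear_functional_with_moments:
  fixes \<mu> :: "nat \<Rightarrow> 'a::field"
  obtains L where "Vector_Spaces.linear smult (*) L" "\<And>n. L (monom 1 n) = \<mu> n"
proof
  define L where "L q = (\<Sum>i\<le>degree q. coeff q i * \<mu> i)" for q
  \<comment> \<open>Any bound from the degree upwards gives the same value, so polynomials of
    different degrees can be compared over a common range.\<close>
  have L: "L q = (\<Sum>i\<le>n. coeff q i * \<mu> i)" if "degree q \<le> n" for q n
    unfolding L_def by (rule sum.mono_neutral_left) (use that in \<open>auto simp: coeff_eq_0\<close>)
  show "Vector_Spaces.linear smult (*) L"
    unfolding Vector_Spaces.linear_iff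
  proof (intro conjI allI)
    show "vector_space (smult :: 'a \<Rightarrow> _)"
      by unfold_locales (simp_all add: smult_add_right smult_add_left)
    show "vector_space ((*) :: 'a \<Rightarrow> _)"
      by unfold_locales (simp_all add: algebra_simps)
    show "L (p + q) = L p + L q" for p q
      using L[of p "max (degree p) (degree q)"] L[of q "max (degree p) (degree q)"]
        L[of "p + q" "max (degree p) (degree q)"] degree_add_le_max[of p q]
      by (simp add: sum.distrib algebra_simps)
    show "L (smult c q) = c * L q" for c q
      using L[of "smult c q" "degree q"] L[of q "degree q"]
      by (simp add: sum_distrib_left mult.assoc degree_smult_le)
  qed
  show "L (monom 1 n) = \<mu> n" for n
    using L[of "monom 1 n" n]
    by (simp add: degree_monom_le if_distrib[of "\<lambda>c. c * _"] cong: if_cong)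
qed

text \<open>At \<open>n = 0\<close> the truncated \<open>n - 1\<close> is \<open>0\<close>, and
  \<open>\<beta> 0 = 0\<close> removes the spurious term. The Gram matrix \<open>h\<close> is
  computed row by row, starting from row \<open>0\<close>, where \<open>p 0 = 1\<close>.\<close>

lemma linear_three_term_recurrence:
  fixes p :: "nat \<Rightarrow> 'a::field poly" and \<alpha> \<beta> :: "nat \<Rightarrow> 'a"
  assumes L: "Vector_Spaces.linear smult (*) L"
    and rec: "\<And>n. monom 1 1 * p n = p (Suc n) + smult (\<alpha> n) (p n) + smult (\<beta> n) (p (n - 1))"
    and \<beta>0: "\<beta> 0 = 0" and \<beta>: "\<And>n. n > 0 \<Longrightarrow> \<beta> n \<noteq> 0"
    and p0: "p 0 = 1" and L1: "L 1 \<noteq> 0" and Lp: "\<And>n. n > 0 \<Longrightarrow> L (p n) = 0"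
  shows "m \<noteq> n \<Longrightarrow> L (p m * p n) = 0" and "L ((p n)\<^sup>2) \<noteq> 0"
proof -
  have add: "L (a + b) = L a + L b" and smult: "L (smult c a) = c * L a" for a b c
    using L unfolding Vector_Spaces.linear_iff by auto
  define h where "h m n = L (p m * p n)" for m n
  have h_commute: "h m n = h n m" for m n by (simp add: h_def mult.commute)
  \<comment> \<open>evaluate \<open>L (w p\<^sub>m p\<^sub>n)\<close> by expanding either \<open>w p\<^sub>m\<close> or \<open>w p\<^sub>n\<close>\<close>
  have swap: "h (Suc m) n + \<alpha> m * h m n + \<beta> m * h (m - 1) n =
      h m (Suc n) + \<alpha> n * h m n + \<beta> n * h m (n - 1)" for m n
  proof -
    have "(monom 1 1 * p m) * p n = p m * (monom 1 1 * p n)" by (simp add: mult_ac)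
    then have "L ((p (Suc m) + smult (\<alpha> m) (p m) + smult (\<beta> m) (p (m - 1))) * p n) =
        L (p m * (p (Suc n) + smult (\<alpha> n) (p n) + smult (\<beta> n) (p (n - 1))))"
      by (simp only: rec)
    then show ?thesis
      by (simp add: h_def algebra_simps add smult)
  qed
  have zero: "h m n = 0" if "m < n" for m n
    using that
  proof (induction m arbitrary: n rule: less_induct)
    case (less m)
    show ?case
    proof (cases m)
      case 0
      then show ?thesis using less.prems Lp by (simp add: h_def p0)
    next
      case (Suc l)
      \<comment> \<open>\<open>swap\<close> at \<open>l\<close> and \<open>n\<close> expresses
        \<open>h m n\<close> by rows up to \<open>l\<close>; since \<open>Suc l < n\<close>, even
        column \<open>n - 1\<close> lies beyond the diagonal.\<close>
      have "\<beta> l * h (l - 1) n = 0"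
        using less.IH[of "l - 1" n] less.prems Suc \<beta>0 by (cases l) auto
      moreover have "h l (Suc n) = 0" "h l n = 0" "h l (n - 1) = 0"
        using less.IH[of l] less.prems Suc by auto
      ultimately show ?thesis using swap[of l n] Suc by (simp del: mult_eq_0_iff)
    qed
  qed
  show "L (p m * p n) = 0" if "m \<noteq> n"
    using zero[of m n] zero[of n m] h_commute[of m n] that unfolding h_def by force
  have "h n n \<noteq> 0"
  proof (induction n)
    case 0
    then show ?case using L1 by (simp add: h_def p0)
  next
    case (Suc n)
    have "\<beta> n * h (n - 1) (Suc n) = 0" by (simp add: zero)
    \<comment> \<open>Only diagonal terms of \<open>swap\<close> survive, so the squared norms build
      up from \<open>L 1\<close> by the factors \<open>\<beta>\<close>.\<close>
    then have "h (Suc n) (Suc n) = \<beta> (Suc n) * h n n"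
      using swap[of n "Suc n"] by (simp add: zero)
    then show ?case using Suc \<beta> by simp
  qed
  then show "L ((p n)\<^sup>2) \<noteq> 0" by (simp add: h_def power2_eq_square)
qed

lemma coeff_sum_monom:
  "coeff (\<Sum>i\<le>n. monom (a i) i) j = (if j \<le> n then a j else 0)"
  by (simp add: coeff_sum)

text \<open>\<open>rec\<close> is the three-term recurrence read at the coefficient of
  \<open>w^j\<close>; its left side is a shift, because multiplication by \<open>w\<close> shifts
  coefficients.\<close>

lemma orthogonal_polys_of_inverse:
  fixes M N :: "nat \<Rightarrow> nat \<Rightarrow> 'a::field"
  assumes p: "is_coefficient_array M p" and diag: "\<And>n. M n n = 1"
    and inv: "inverse_ltri M N"
    and \<beta>: "\<beta> 0 = 0" "\<And>n. n > 0 \<Longrightarrow> \<beta> n \<noteq> 0"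
    and rec: "\<And>n j. (if j = 0 then 0 else M n (j - 1)) =
                M (Suc n) j + \<alpha> n * M n j + \<beta> n * M (n - 1) j"
  shows "orthogonal_polys p (\<lambda>n. N n 0)"
proof -
  have M0: "M n j = 0" if "n < j" for n j
    using p that by (simp add: is_coefficient_array_def lower_triangular_def)
  have p_eq: "p n = (\<Sum>j\<le>n. monom (M n j) j)" for n
    using p by (simp add: is_coefficient_array_def)
  have coeff_p: "coeff (p n) j = M n j" for n j
    using M0 by (simp add: p_eq coeff_sum_monom)
  have deg: "degree (p n) = n" for n
    by (rule antisym[OF degree_le le_degree]) (simp_all add: coeff_p diag M0)
  obtain L where L: "Vector_Spaces.linear smult (*) L" and mom: "\<And>n. L (monom 1 n) = N n 0"
    using linear_functional_with_moments[of "\<lambda>n. N n 0"] by blast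
  interpret L: Vector_Spaces.linear smult "(*)" L by (fact L)
  have "L (p n) = (\<Sum>j\<le>n. L (smult (M n j) (monom 1 j)))" for n
    by (simp add: p_eq L.sum smult_monom)
  then have "L (p n) = ltri_mult M N n 0" for n
    by (simp add: L.scale mom ltri_mult_def)
  then have Lp: "L (p n) = (if n = 0 then 1 else 0)" for n
    using inv by (simp add: inverse_ltri_def identity_matrix_def)
  have p0: "p 0 = 1" by (simp add: p_eq diag)
  have "monom 1 1 * p n = p (Suc n) + smult (\<alpha> n) (p n) + smult (\<beta> n) (p (n - 1))" for n
  proof (rule poly_eqI)
    fix j
    show "coeff (monom 1 1 * p n) j =
        coeff (p (Suc n) + smult (\<alpha> n) (p n) + smult (\<beta> n) (p (n - 1))) j"
      using rec[where n = n and j = j] by (cases j) (simp_all add: coeff_monom_mult coeff_p)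
  qed
  note ortho = linear_three_term_recurrence[OF L this \<beta> p0]
  have "L (p m * p n) = 0" if "m \<noteq> n" for m n
    using ortho(1)[OF _ _ _ that] Lp p0 by (metis Lp less_irrefl zero_neq_one)
  moreover have "L ((p n)\<^sup>2) \<noteq> 0" for n
    using ortho(2) Lp p0 by (metis Lp less_irrefl zero_neq_one)
  ultimately show ?thesis
    unfolding orthogonal_polys_def using deg coeff_p diag L mom by metis
qed

subsection \<open>The Riordan array of the \<open>1/k\<close>-Eulerian polynomials\<close>

text \<open>The factor \<open>k ^ n\<close> amounts to replacing \<open>z\<close> by
  \<open>k z\<close> in the generating function.\<close>

lemma eulerian_1k_eq:
  fixes x k :: "'a::field_char_0"
  assumes "x \<noteq> 1"
  shows "eulerian_1k k n x =
    fact n * fps_cpow (fps_const (1 - x) / (fps_exp (k * (x - 1)) - fps_const x)) (1 / k) $ n"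
proof -
  let ?u = "fps_const (1 - x) / (fps_exp (x - 1) - fps_const x)"
  let ?h = "fps_const k * fps_X"
  have "?u oo ?h = fps_const (1 - x) / (fps_exp (k * (x - 1)) - fps_const x)"
    using assms by (subst fps_divide_compose) (simp_all add: fps_compose_sub_distrib)
  moreover have "?u $ 0 = 1"
    using assms by (simp add: fps_divide_unit)
  ultimately have "fps_cpow (fps_const (1 - x) / (fps_exp (k * (x - 1)) - fps_const x)) (1 / k) =
      fps_cpow ?u (1 / k) oo ?h"
    by (simp add: fps_cpow_compose)
  then show ?thesis
    by (simp add: eulerian_1k_def savage_viswanathan_def)
qed

text \<open>The computation is done over any field of characteristic 0; further conditions on
  \<open>x\<close> and \<open>k\<close> enter only with orthogonality.\<close>

locale eulerian_riordan =
  fixes x k :: "'a::field_char_0" and g f G F :: "'a fps"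
  assumes x1: "x \<noteq> 1" and k0: "k \<noteq> 0"
    and g: "g = 1 / fps_cpow (1 + fps_const k * fps_X) (1 / k)"
    and f: "f = fps_const (1 / (k * (1 - x))) *
                  fps_log ((1 + fps_const k * fps_X) / (1 + fps_const (k * x) * fps_X))"
    and G: "G = fps_cpow (fps_const (1 - x) / (fps_exp (k * (x - 1)) - fps_const x)) (1 / k)"
    and F: "F = (fps_exp k - fps_exp (k * x)) /
                  (fps_const k * (fps_exp (k * x) - fps_const x * fps_exp k))"
begin

section \<open>Linear factors, constant terms and differential equations of \<open>f\<close> and
  \<open>g\<close>\<close>

abbreviation "A \<equiv> 1 + fps_const k * fps_X"
abbreviation "B \<equiv> 1 + fps_const (k * x) * fps_X"

lemma B_neq_0: "B \<noteq> 0"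
proof -
  have "B $ 0 \<noteq> 0" by simp
  then show ?thesis by (metis fps_zero_nth)
qed

lemma AB_nth_0: "(A / B) $ 0 = 1"
  by (simp add: fps_divide_unit)

lemma AB_mult: "A / B * B = A"
  by (simp add: fps_divide_unit mult.assoc inverse_mult_eq_1)

text \<open>The terms in \<open>z\<close> cancel. This collapses the denominators of both
  \<open>G oo f\<close> and \<open>F oo f\<close>.\<close>

lemma B_minus_xA: "B - fps_const x * A = fps_const (1 - x)"
  by (simp add: algebra_simps flip: fps_const_mult fps_const_sub)

lemma f_nth_0: "f $ 0 = 0"
  by (simp add: f)

lemma g_nth_0: "g $ 0 = 1"
  by (simp add: g fps_divide_unit)

lemma F_nth_0: "F $ 0 = 0"
  using x1 k0 by (simp add: F fps_divide_unit)

text \<open>Partial fractions: \<open>k / A - k x / B = k (1 - x) / (A B)\<close>, and the prefactor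
  of \<open>f\<close> removes \<open>k (1 - x)\<close>.\<close>

lemma deriv_f: "A * B * fps_deriv f = 1"
proof -
  let ?l = "fps_log (A / B)"
  let ?q = "A / B"
  have "fps_deriv (?q * B) = fps_const k"
    unfolding AB_mult by simp
  then have "?q * fps_const (k * x) + fps_deriv ?q * B = fps_const k"
    unfolding fps_deriv_mult by simp
  then have q: "fps_deriv ?q * B = fps_const k - ?q * fps_const (k * x)"
    by (metis add_diff_cancel_left')
  \<comment> \<open>The extra factor \<open>B\<close> leaves room to rewrite \<open>A\<close> as
    \<open>?q * B\<close>, which exposes \<open>?q * fps_deriv ?l\<close>; it is cancelled at the
    end.\<close>
  have "B * (A * B * fps_deriv ?l) = B * B * B * (?q * fps_deriv ?l)"
    by (subst (1) AB_mult[symmetric]) (simp only: mult_ac)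
  also have "\<dots> = B * B * (fps_deriv ?q * B)"
    unfolding fps_deriv_log[OF AB_nth_0] by (simp only: mult_ac)
  also have "\<dots> = B * (fps_const k * B - (?q * B) * fps_const (k * x))"
    unfolding q by (simp only: algebra_simps)
  also have "fps_const k * B - (?q * B) * fps_const (k * x) = fps_const (k * (1 - x))"
    unfolding AB_mult by (simp add: algebra_simps flip: fps_const_mult fps_const_sub)
  finally have "A * B * fps_deriv ?l = fps_const (k * (1 - x))"
    by (rule iffD1[OF mult_left_cancel[OF B_neq_0]])
  moreover have "fps_deriv f = fps_const (1 / (k * (1 - x))) * fps_deriv ?l"
    by (simp add: f)
  ultimately have "A * B * fps_deriv f = fps_const (1 / (k * (1 - x))) * fps_const (k * (1 - x))"
    by (metis mult.left_commute)
  also have "\<dots> = 1" using k0 x1 by simp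
  finally show ?thesis .
qed

text \<open>\<open>g\<close> is \<open>A\<close> to the power \<open>-1/k\<close>, and the exponent
  cancels the \<open>k\<close> from the derivative of \<open>A\<close>.\<close>

lemma deriv_g: "A * fps_deriv g = - g"
proof -
  let ?c = "fps_cpow A (1 / k)"
  have gc: "g * ?c = 1"
    by (simp add: g fps_divide_unit inverse_mult_eq_1)
  have "g * fps_deriv ?c + fps_deriv g * ?c = fps_deriv (g * ?c)"
    by (rule fps_deriv_mult[symmetric])
  also have "\<dots> = 0" unfolding gc by simp
  finally have "fps_deriv g * ?c = - (g * fps_deriv ?c)"
    by (simp add: eq_neg_iff_add_eq_0 add.commute)
  then have "A * fps_deriv g * ?c = - g * (A * fps_deriv ?c)"
    by (simp only: mult.assoc mult_minus_left mult_minus_right mult.left_commute)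
  also have "A * fps_deriv ?c = ?c"
    by (subst fps_deriv_cpow) (use k0 in simp_all)
  finally show ?thesis
    by (metis fps_cpow_neq_0 mult_right_cancel)
qed

lemma f_nth_1: "f $ 1 = 1"
proof -
  have "(A * B * fps_deriv f) $ 0 = 1" by (simp add: deriv_f)
  then show ?thesis by simp
qed

section \<open>Evaluation of \<open>G\<close> and \<open>F\<close> at \<open>f\<close>\<close>

lemma exp_compose_f: "fps_exp (k * (1 - x)) oo f = A / B"
proof -
  have "fps_const (k * (1 - x)) * f = fps_log (A / B)"
    using k0 x1 by (simp add: f mult.assoc[symmetric])
  then show ?thesis
    unfolding fps_exp_compose[OF f_nth_0, of "k * (1 - x)"]
    by (simp only: fps_exp_compose_log[OF AB_nth_0])
qed

text \<open>\<open>exp (k (x - 1) f) = B / A\<close>, so the base of the power becomes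
  \<open>(1 - x) / (B / A - x) = (1 - x) A / (B - x A) = A\<close>.\<close>

lemma G_compose_f: "G oo f = fps_cpow A (1 / k)"
proof -
  let ?u = "fps_const (1 - x) / (fps_exp (k * (x - 1)) - fps_const x)"
  let ?e = "fps_exp (k * (x - 1)) oo f"
  have "fps_exp (k * (1 - x)) * fps_exp (k * (x - 1)) = (1 :: 'a fps)"
    by (subst fps_exp_add_mult[symmetric]) (simp add: algebra_simps)
  then have "(A / B) * ?e = 1"
    unfolding exp_compose_f[symmetric]
    by (subst fps_compose_mult_distrib[OF f_nth_0, symmetric]) simp
  then have "(A / B * ?e) * B = B" by (simp only: mult_1_left)
  also have "(A / B * ?e) * B = ?e * (A / B * B)" by (simp only: mult_ac)
  finally have eA: "?e * A = B" by (simp only: AB_mult)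
  have u0: "?u $ 0 = 1" using x1 by (simp add: fps_divide_unit)
  have "?u oo f = fps_const (1 - x) / (?e - fps_const x)"
    using x1 by (subst fps_divide_compose) (simp_all add: fps_compose_sub_distrib f_nth_0)
  also have "\<dots> = A"
  proof (rule fps_div_eqI)
    have "A * (?e - fps_const x) = B - fps_const x * A"
      using eA by (simp add: right_diff_distrib mult.commute)
    then show eq: "fps_const (1 - x) = A * (?e - fps_const x)"
      by (simp only: B_minus_xA)
    show "?e - fps_const x \<noteq> 0"
      using eq x1 by auto
  qed
  finally show ?thesis
    unfolding G by (simp only: fps_cpow_compose[OF f_nth_0 u0])
qed

text \<open>With \<open>Y = exp (k x f)\<close> and \<open>Z = exp (k f) = Y A / B\<close> the
  quotient becomes \<open>(A - B) / (k (B - x A))\<close>, where \<open>A - B = k (1 - x) z\<close>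
  and \<open>B - x A = 1 - x\<close>.\<close>

lemma F_compose_f: "F oo f = fps_X"
proof -
  let ?Y = "fps_exp (k * x) oo f"
  let ?Z = "fps_exp k oo f"
  have Y0: "?Y \<noteq> 0"
  proof
    assume "?Y = 0"
    then have "?Y $ 0 = 0" by simp
    then show False by simp
  qed
  have "fps_exp k = fps_exp (k * x) * fps_exp (k * (1 - x))"
    by (subst fps_exp_add_mult[symmetric]) (simp add: algebra_simps)
  then have "?Z = ?Y * (A / B)"
    by (simp add: fps_compose_mult_distrib[OF f_nth_0] exp_compose_f)
  then have Z: "?Z * B = ?Y * A"
    by (simp only: mult.assoc AB_mult)
  have "F oo f = (?Z - ?Y) / (fps_const k * (?Y - fps_const x * ?Z))"
    unfolding F using x1 k0
    by (subst fps_divide_compose)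
       (simp_all add: fps_compose_sub_distrib fps_compose_mult_distrib f_nth_0)
  also have "\<dots> = fps_X"
  proof (rule fps_div_eqI)
    have "(?Y - fps_const x * ?Z) * B = ?Y * (B - fps_const x * A)"
      unfolding left_diff_distrib right_diff_distrib mult.assoc Z
      by (simp only: mult.left_commute)
    then have D: "(?Y - fps_const x * ?Z) * B = ?Y * fps_const (1 - x)"
      by (simp only: B_minus_xA)
    have "?Y * fps_const (1 - x) \<noteq> 0" using Y0 x1 by simp
    then have "?Y - fps_const x * ?Z \<noteq> 0"
      unfolding D[symmetric] by (rule contrapos_nn) (simp only: mult_zero_left)
    then show "fps_const k * (?Y - fps_const x * ?Z) \<noteq> 0"
      using k0 by (simp only: mult_eq_0_iff fps_const_eq_0_iff simp_thms)
    have "(?Z - ?Y) * B = ?Y * (A - B)"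
      using Z by (simp only: left_diff_distrib right_diff_distrib)
    also have "A - B = fps_X * fps_const k * fps_const (1 - x)"
      by (simp add: algebra_simps flip: fps_const_mult fps_const_sub)
    also have "?Y * \<dots> = fps_X * fps_const k * (?Y * fps_const (1 - x))"
      by (simp only: mult_ac)
    also have "\<dots> = (fps_X * (fps_const k * (?Y - fps_const x * ?Z))) * B"
      unfolding D[symmetric] by (simp only: mult_ac)
    finally show "?Z - ?Y = fps_X * (fps_const k * (?Y - fps_const x * ?Z))"
      by (rule iffD1[OF mult_right_cancel[OF B_neq_0]])
  qed
  finally show ?thesis .
qed

section \<open>Inverse array, initial column, recurrence and orthogonality\<close>

lemma riordan_pairs: "riordan_pair g f" "riordan_pair G F"
proof -
  show "riordan_pair g f"
    by (simp add: riordan_pair_def f_nth_0 f_nth_1 g_nth_0 flip: One_nat_def)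
  \<comment> \<open>Comparing coefficients of \<open>z\<close> in \<open>F oo f = z\<close> yields
    \<open>F $ 1\<close> without expanding the quotient.\<close>
  have "(F oo f) $ 1 = F $ 1"
    using f_nth_1 by (simp add: fps_compose_nth F_nth_0)
  then have "F $ 1 = 1" by (simp add: F_compose_f)
  then show "riordan_pair G F"
    by (simp add: riordan_pair_def F_nth_0 G)
qed

lemma inverse: "inverse_ltri (exp_riordan g f) (exp_riordan G F)"
proof (rule inverse_ltri_exp_riordan)
  show "g * (G oo f) = 1"
    unfolding G_compose_f by (simp add: g fps_divide_unit inverse_mult_eq_1)
qed (simp_all only: f_nth_0 f_nth_1 F_nth_0 F_compose_f, simp)

lemma first_column: "exp_riordan G F n 0 = eulerian_1k k n x"
  by (simp add: exp_riordan_column eulerian_1k_eq[OF x1] G)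

text \<open>Under \<open>n! [z^n]\<close> the series \<open>a'\<close>, \<open>z a'\<close>,
  \<open>z^2 a'\<close> and \<open>z a\<close> give entries of rows \<open>n + 1\<close>,
  \<open>n\<close>, \<open>n - 1\<close> and \<open>n - 1\<close> with factors \<open>1\<close>,
  \<open>n\<close>, \<open>n (n - 1)\<close> and \<open>n\<close>; the last two combine to
  \<open>x k n (1 + k (n - 1))\<close>.\<close>

lemma exp_riordan_recurrence:
  "(if j = 0 then 0 else exp_riordan g f n (j - 1)) =
     exp_riordan g f (Suc n) j + (1 + k * (1 + x) * of_nat n) * exp_riordan g f n j +
     x * k * of_nat n * (1 + k * (of_nat n - 1)) * exp_riordan g f (n - 1) j"
proof -
  define a where "a j = g * (fps_const (1 / fact j) * f ^ j)" for j
  \<comment> \<open>The derivative of \<open>f^j / j!\<close> is \<open>f' f^(j-1) / (j-1)!\<close>,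
    and vanishes for \<open>j = 0\<close>; hence column \<open>j - 1\<close> appears.\<close>
  define b where "b = (if j = 0 then 0 else a (j - 1))"
  have deriv: "fps_deriv (a j) = fps_deriv g * (fps_const (1 / fact j) * f ^ j) + b * fps_deriv f"
  proof (cases j)
    case 0
    then show ?thesis by (simp add: a_def b_def)
  next
    case (Suc i)
    have "fps_const (1 / fact j) * fps_deriv (f ^ j) = fps_const (1 / fact i) * f ^ i * fps_deriv f"
      unfolding Suc fps_deriv_power
      by (simp add: mult.assoc[symmetric] del: of_nat_Suc power_Suc)
    then show ?thesis by (simp add: a_def b_def Suc mult.assoc)
  qed
  have "A * B * fps_deriv (a j) =
      B * (A * fps_deriv g) * (fps_const (1 / fact j) * f ^ j) + b * (A * B * fps_deriv f)"
    unfolding deriv by (simp only: algebra_simps)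
  then have ode: "A * B * fps_deriv (a j) = b - B * a j"
    unfolding deriv_g deriv_f by (simp add: a_def)
  \<comment> \<open>Horner form in \<open>fps_X\<close>, so that coefficients are extracted one
    shift at a time.\<close>
  have AB: "A * B = 1 + fps_X * (fps_const (k * (1 + x)) + fps_X * fps_const (k * k * x))"
    by (simp add: algebra_simps flip: fps_const_mult fps_const_add)
  have "b = fps_deriv (a j) + fps_X * (fps_const (k * (1 + x)) * fps_deriv (a j) +
      fps_X * (fps_const (k * k * x) * fps_deriv (a j))) + a j + fps_X * (fps_const (k * x) * a j)"
    using ode unfolding AB by (simp add: algebra_simps)
  then have b: "b $ n = (fps_deriv (a j) + fps_X * (fps_const (k * (1 + x)) * fps_deriv (a j) +
      fps_X * (fps_const (k * k * x) * fps_deriv (a j))) + a j + fps_X * (fps_const (k * x) * a j)) $ n"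
    by simp
  have coeff: "exp_riordan g f n j = fact n * a j $ n" for n j
    by (simp add: exp_riordan_column a_def)
  have lhs: "(if j = 0 then 0 else exp_riordan g f n (j - 1)) = fact n * b $ n"
    by (simp add: coeff b_def)
  show ?thesis
  proof (cases n)
    case 0
    then show ?thesis unfolding lhs b by (simp add: coeff)
  next
    case (Suc m)
    show ?thesis
    proof (cases m)
      case 0
      then show ?thesis unfolding lhs b unfolding Suc by (simp add: coeff algebra_simps)
    next
      case (Suc l)
      then show ?thesis
        unfolding lhs b unfolding \<open>n = Suc m\<close> by (simp add: coeff algebra_simps)
    qed
  qed
qed

text \<open>The first two assumptions keep \<open>x k n (1 + k (n - 1))\<close> nonzero for
  \<open>n > 0\<close>.\<close>

lemma orthogonal:
  assumes "x \<noteq> 0" and "\<And>n. 1 + k * of_nat n \<noteq> 0"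
    and "is_coefficient_array (exp_riordan g f) p"
  shows "orthogonal_polys p (\<lambda>n. eulerian_1k k n x)"
proof -
  let ?\<beta> = "\<lambda>n. x * k * of_nat n * (1 + k * (of_nat n - 1))"
  have "orthogonal_polys p (\<lambda>n. exp_riordan G F n 0)"
  proof (rule orthogonal_polys_of_inverse[OF assms(3) _ inverse])
    show "exp_riordan g f n n = 1" for n
      by (simp only: exp_riordan_diag[OF f_nth_0] f_nth_1 g_nth_0) simp
    show "?\<beta> 0 = 0" by simp
    show "?\<beta> n \<noteq> 0" if "n > 0" for n
      using that assms(1) k0 assms(2)[of "n - 1"] by (simp add: of_nat_diff)
  qed (rule exp_riordan_recurrence)
  then show ?thesis by (simp add: first_column)
qed

end

section \<open>Specialisation to the field of rational functions in \<open>x\<close> and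
  \<open>k\<close>\<close>

theorem proposition1:
  fixes x k :: rat_fun2
    and M N :: "nat \<Rightarrow> nat \<Rightarrow> rat_fun2"
    and g f G F :: "rat_fun2 fps"
  assumes x: "x = indet_x" and k: "k = indet_k"
    and g: "g = 1 / fps_cpow (1 + fps_const k * fps_X) (1 / k)"
    and f: "f = fps_const (1 / (k * (1 - x))) *
                  fps_log ((1 + fps_const k * fps_X) / (1 + fps_const (k * x) * fps_X))"
    and M: "M = exp_riordan g f"
    and G: "G = fps_cpow (fps_const (1 - x) / (fps_exp (k * (x - 1)) - fps_const x)) (1 / k)"
    and F: "F = (fps_exp k - fps_exp (k * x)) /
                  (fps_const k * (fps_exp (k * x) - fps_const x * fps_exp k))"
    and N: "N = exp_riordan G F"
  shows "riordan_pair g f \<and> riordan_pair G F \<and>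
    (\<exists>p. is_coefficient_array M p \<and> orthogonal_polys p (\<lambda>n. eulerian_1k k n x)) \<and>
    inverse_ltri M N \<and>
    (\<forall>n. N n 0 = eulerian_1k k n x)"
proof -
  have x0: "x \<noteq> 0" by (simp add: x indet_x_def)
  have x1: "x \<noteq> 1"
    by (simp add: x indet_x_def one_pCons flip: to_fract_1)
  have k0: "k \<noteq> 0" by (simp add: k indet_k_def)
  have kn: "1 + k * of_nat n \<noteq> 0" for n
  proof -
    have "of_nat n = to_fract (of_nat n :: rat poly poly)"
      by (induction n) simp_all
    then have "1 + k * of_nat n = to_fract (1 + [:0, 1:] * of_nat n)"
      by (simp only: k indet_k_def to_fract_add to_fract_mult to_fract_1)
    \<comment> \<open>As a polynomial in \<open>k\<close>, \<open>1 + k n\<close> has constant term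
      \<open>1\<close>, which is its value at \<open>k = 0\<close>.\<close>
    moreover have "poly (1 + [:0, 1:] * of_nat n) 0 \<noteq> (0 :: rat poly)" by simp
    ultimately show ?thesis by (metis poly_0 to_fract_eq_0_iff)
  qed
  interpret eulerian_riordan x k g f G F
    using x1 k0 g f G F by unfold_locales
  define p where "p n = (\<Sum>j\<le>n. monom (M n j) j)" for n
  have "is_coefficient_array M p"
    using inverse by (simp add: is_coefficient_array_def inverse_ltri_def p_def M)
  then show ?thesis
    using riordan_pairs inverse first_column orthogonal[OF x0 kn] unfolding M N by blast
qed

end
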